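(* Let $0<\sigma<1$. The Cauchy problem for the incompressible Euler equations in three dimensions, $$u_t+u\cdot\nabla u+\nabla p=0,\qquad \mathrm{div}\,u=0,\qquad u(0)=u_0,\qquad t\ge0,\ x\in\mathbb{R}^3,$$ is locally ill-posed in the sense of Hadamard in the classical Hölder space $C^{1+\sigma}(\mathbb{R}^3)$: the data-to-solution map $u_0\mapsto u$ is not continuous in $C^{1+\sigma}(\mathbb{R}^3)$.
   Context: A Cauchy problem is locally (in time) well-posed in a Banach space $X$ in the sense of Hadamard if given any initial data $u_0\in X$ there is a time $T>0$ and a unique solution $u$ in a Banach space $Y\subset C([0,T),X)$ which depends continuously on the initial data; otherwise it is locally ill-posed. Loss of continuity of the data-to-solution map is measured by the norm $\|u(t)-v(t)\|_{C^{1+\sigma}}$ of the difference of two solutions $u,v$ against the norm $\|u_0-v_0\|_{C^{1+\sigma}}$ of the difference of their initial data. The vector fields in $C^{1+\sigma}(\mathbb{R}^3)$ are bounded together with their first derivatives, with first derivatives Hölder continuous of exponent $\sigma$; no decay at infinity is required. *)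

theory Defs
  imports "HOL-Analysis.Analysis"
begin

type_synonym vfield = "real^3 \<Rightarrow> real^3"

section \<open>The Hoelder space of exponent 1 + s on three-space\<close>

definition holder_space :: "real \<Rightarrow> vfield set" where
  "holder_space s = {f.
     (\<forall>x. f differentiable (at x)) \<and>
     bounded (range f) \<and>
     bounded (range (\<lambda>x. jacobian f (at x))) \<and>
     (\<exists>C. \<forall>x y. norm (jacobian f (at x) - jacobian f (at y)) \<le> C * dist x y powr s)}"

text \<open>The suprema are those of real numbers, so the value is only meaningful on
  \<^term>\<open>holder_space s\<close>, where they are all finite.\<close>

definition holder_norm :: "real \<Rightarrow> vfield \<Rightarrow> real" where
  "holder_norm s f =
     (SUP x. norm (f x)) +
     (SUP x. norm (jacobian f (at x))) +
     (SUP (x, y) \<in> {(x, y). x \<noteq> y}.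
        norm (jacobian f (at x) - jacobian f (at y)) / dist x y powr s)"

definition holder_dist :: "real \<Rightarrow> vfield \<Rightarrow> vfield \<Rightarrow> real" where
  "holder_dist s f g = holder_norm s (\<lambda>x. f x - g x)"

definition divergence :: "vfield \<Rightarrow> real^3 \<Rightarrow> real" where
  "divergence f x = trace (jacobian f (at x))"

definition initial_data :: "real \<Rightarrow> vfield set" where
  "initial_data s = {u0 \<in> holder_space s. \<forall>x. divergence u0 x = 0}"

section \<open>Solutions of the Euler equations\<close>

text \<open>\<^term>\<open>G t x\<close> is the pressure gradient. The time derivative at 0 is one-sided.
  Since velocities need not decay, the pressure has to be normalised: otherwise
  \<open>u(t,x) = g(t)\<close>, \<open>p(t,x) = - g'(t) \<bullet> x\<close> solves the equations for every curve \<open>g\<close>, and the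
  initial value would not determine the solution. Sublinear growth of the pressure at spatial
  infinity removes these spurious solutions: it makes the pressure gradient the one obtained from
  the velocity through the Riesz transforms.\<close>

definition euler_solution ::
  "real \<Rightarrow> real \<Rightarrow> vfield \<Rightarrow> (real \<Rightarrow> vfield) \<Rightarrow> bool" where
  "euler_solution s T u0 u \<longleftrightarrow>
     (\<forall>t\<in>{0..<T}. u t \<in> holder_space s) \<and>
     (\<forall>\<tau>\<in>{0..<T}. bounded ((\<lambda>t. holder_norm s (u t)) ` {0..\<tau>})) \<and>
     u 0 = u0 \<and>
     (\<forall>t\<in>{0..<T}. \<forall>x. divergence (u t) x = 0) \<and>
     (\<exists>p G.
        (\<forall>t\<in>{0..<T}. \<forall>x. GDERIV (p t) x :> G t x) \<and>
        continuous_on ({0..<T} \<times> UNIV) (\<lambda>(t, x). G t x) \<and>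
        (\<forall>t\<in>{0..<T}. ((\<lambda>x. p t x / norm x) \<longlongrightarrow> 0) at_infinity) \<and>
        (\<forall>t\<in>{0..<T}. \<forall>x.
           ((\<lambda>r. u r x) has_vector_derivative
              - (jacobian (u t) (at x) *v u t x) - G t x) (at t within {0..<T})))"

section \<open>Local well-posedness in the sense of Hadamard\<close>

text \<open>Curves are set to zero outside \<open>[0,T)\<close>, so that equality of functions is equality
  on \<open>[0,T)\<close>.\<close>

definition continuous_curves :: "real \<Rightarrow> real \<Rightarrow> (real \<Rightarrow> vfield) set" where
  "continuous_curves s T = {u.
     (\<forall>t\<in>{0..<T}. u t \<in> holder_space s) \<and>
     (\<forall>t\<in>{0..<T}. ((\<lambda>r. holder_dist s (u r) (u t)) \<longlongrightarrow> 0) (at t within {0..<T})) \<and>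
     (\<forall>t. t \<notin> {0..<T} \<longrightarrow> u t = (\<lambda>x. 0))}"

definition banach_space_on ::
  "(real \<Rightarrow> vfield) set \<Rightarrow> ((real \<Rightarrow> vfield) \<Rightarrow> real) \<Rightarrow> bool" where
  "banach_space_on Y N \<longleftrightarrow>
     (\<lambda>t x. 0) \<in> Y \<and>
     (\<forall>u\<in>Y. \<forall>v\<in>Y. (\<lambda>t x. u t x + v t x) \<in> Y) \<and>
     (\<forall>c. \<forall>u\<in>Y. (\<lambda>t x. c *\<^sub>R u t x) \<in> Y) \<and>
     (\<forall>u\<in>Y. 0 \<le> N u \<and> (N u = 0 \<longleftrightarrow> u = (\<lambda>t x. 0))) \<and>
     (\<forall>c. \<forall>u\<in>Y. N (\<lambda>t x. c *\<^sub>R u t x) = \<bar>c\<bar> * N u) \<and>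
     (\<forall>u\<in>Y. \<forall>v\<in>Y. N (\<lambda>t x. u t x + v t x) \<le> N u + N v) \<and>
     (\<forall>w :: nat \<Rightarrow> real \<Rightarrow> vfield.
        (\<forall>n. w n \<in> Y) \<and>
        (\<forall>e>0. \<exists>M. \<forall>m\<ge>M. \<forall>n\<ge>M. N (\<lambda>t x. w m t x - w n t x) < e)
        \<longrightarrow> (\<exists>u\<in>Y. (\<lambda>n. N (\<lambda>t x. w n t x - u t x)) \<longlonglongrightarrow> 0))"

text \<open>For continuous dependence to be meaningful, all data in some ball around \<open>u0\<close> must have
  a unique solution in the same space \<open>Y\<close>; \<open>S\<close> is the resulting data-to-solution map.\<close>

definition locally_well_posed :: "real \<Rightarrow> bool" where
  "locally_well_posed s \<longleftrightarrow>
     (\<forall>u0 \<in> initial_data s. \<exists>T>0. \<exists>Y N. \<exists>r>0. \<exists>S.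
        banach_space_on Y N \<and> Y \<subseteq> continuous_curves s T \<and>
        (\<forall>v0 \<in> initial_data s. holder_dist s v0 u0 < r \<longrightarrow>
           S v0 \<in> Y \<and> euler_solution s T v0 (S v0) \<and>
           (\<forall>v\<in>Y. euler_solution s T v0 v \<longrightarrow> v = S v0)) \<and>
        (\<forall>t\<in>{0..<T}. \<forall>e>0. \<exists>d>0. \<forall>v0 \<in> initial_data s.
           holder_dist s v0 u0 < r \<and> holder_dist s v0 u0 < d \<longrightarrow>
           holder_dist s (S v0 t) (S u0 t) < e))"

definition locally_ill_posed :: "real \<Rightarrow> bool" where
  "locally_ill_posed s \<longleftrightarrow> \<not> locally_well_posed s"

section \<open>Continuity of the data-to-solution map\<close>

text \<open>Continuity, at time \<open>t\<close>, of the map from data possessing a solution on \<open>[0,T)\<close>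
  to that solution. Solutions here need not be continuous in time for the Hoelder norm.\<close>

definition data_to_solution_continuous :: "real \<Rightarrow> real \<Rightarrow> real \<Rightarrow> bool" where
  "data_to_solution_continuous s T t \<longleftrightarrow>
     (\<forall>u0 u. euler_solution s T u0 u \<longrightarrow>
        (\<forall>e>0. \<exists>d>0. \<forall>v0 v.
           euler_solution s T v0 v \<and> holder_dist s v0 u0 < d \<longrightarrow>
           holder_dist s (v t) (u t) < e))"

end

theory Submission
  imports Defs
begin

text \<open>
  Translation is discontinuous in Hoelder spaces: if \<open>k(y)\<close> behaves like \<open>\<bar>y\<bar>\<^sup>s\<close> near 0, then
  \<open>k(y - a) - k(y)\<close> takes the values \<open>k(- a)\<close> at 0 and \<open>- k(a)\<close> at \<open>a\<close>, so its Hoelder quotient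
  over this pair does not tend to 0 with \<open>a\<close>. The Euler equations translate such a profile: for
  every constant \<open>c\<close> the shear flow \<open>u(t,x) = (c, 0, h(x\<^sub>1 - c t))\<close> is an exact solution with zero
  pressure. The profile used is \<open>h = sin \<cdot> \<bar>sin\<bar>\<^sup>s\<close>, which is bounded and has a derivative with a
  cusp of exponent \<open>s\<close> at 0.

  For the data-to-solution map, compare \<open>c = 0\<close> with a small \<open>c > 0\<close>. The data differ by the
  constant field \<open>(c, 0, 0)\<close>, of norm \<open>c\<close>, while at time \<open>t\<close> the two profiles are shifted against each
  other by \<open>c t\<close>, so the solutions stay at distance at least 1/2
  (\<open>holder_dist_shifted_cusp_ge\<close>).

  For local well-posedness a solution in the unknown space \<open>Y\<close> need not be the shear flow, so it has
  to be excluded without appealing to uniqueness. The datum with \<open>c = 1\<close> has no solution at all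
  that is continuous in time with values in the Hoelder space
  (\<open>no_hoelder_continuous_solution\<close>). Take the circulation \<open>\<Gamma>\<close> of the
  velocity around a fixed square of side \<open>d\<close> with a side on the cusp plane \<open>x\<^sub>1 = 0\<close>. The pressure
  does not contribute, so \<open>\<Gamma>'\<close> is minus the circulation of the advection term. At time 0 the latter
  is \<open>d h'(d)\<close>, at least \<open>d\<^bsup>1+s\<^esup> / 4\<close>. Up to some time \<open>t > 0\<close> that does not depend on \<open>d\<close>, continuity in
  the Hoelder norm keeps the advection term so close to its initial value in the Hoelder seminorm
  that its circulation stays above \<open>d\<^bsup>1+s\<^esup> / 8\<close>. Thus \<open>\<bar>\<Gamma>(t) - \<Gamma>(0)\<bar> \<ge> t d\<^bsup>1+s\<^esup> / 8\<close>. On the other hand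
  this difference is at most of order \<open>d\<^sup>2\<close>, because the velocities are Lipschitz. As \<open>s < 1\<close>, the two
  bounds are incompatible for small \<open>d\<close>.
\<close>

section \<open>Norm estimates in the Hoelder space\<close>

lemma jacobian_eqI:
  fixes J :: "real^'n^'m"
  assumes "(f has_derivative (\<lambda>y. J *v y)) (at x)"
  shows "jacobian f (at x) = J"
  unfolding jacobian_def frechet_derivative_at[OF assms, symmetric]
  by (rule matrix_of_matrix_vector_mul)

lemma jacobian_diff:
  fixes f g :: "real^'n \<Rightarrow> real^'m"
  assumes "f differentiable (at x)" and "g differentiable (at x)"
  shows "jacobian (\<lambda>x. f x - g x) (at x) = jacobian f (at x) - jacobian g (at x)"
proof (rule jacobian_eqI)
  have "(f has_derivative (\<lambda>y. jacobian f (at x) *v y)) (at x)"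
    "(g has_derivative (\<lambda>y. jacobian g (at x) *v y)) (at x)"
    using assms jacobian_works by blast+
  from has_derivative_diff[OF this]
  show "((\<lambda>x. f x - g x) has_derivative (*v) (jacobian f (at x) - jacobian g (at x))) (at x)"
    by (simp flip: matrix_vector_mult_diff_rdistrib)
qed

lemma norm_matrix_vector_mult_le:
  fixes A :: "real^'n^'m" and x :: "real^'n"
  shows "norm (A *v x) \<le> norm A * norm x"
proof -
  have "norm (A *v x) \<le> L2_set (\<lambda>i. norm (A $ i) * norm x) UNIV"
    unfolding norm_vec_def[of "A *v x"]
    by (intro L2_set_mono) (auto simp: matrix_vector_mul_component intro: Cauchy_Schwarz_ineq2)
  also have "\<dots> = norm A * norm x"
    by (simp add: L2_set_left_distrib norm_vec_def[of A])
  finally show ?thesis .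
qed

lemma bounded_bilinear_matrix_vector_mult:
  "bounded_bilinear ((*v) :: real^'n^'m \<Rightarrow> real^'n \<Rightarrow> real^'m)"
proof
  show "\<exists>K. \<forall>(A :: real^'n^'m) (x :: real^'n). norm (A *v x) \<le> norm A * norm x * K"
    by (intro exI[of _ 1] allI) (simp add: norm_matrix_vector_mult_le)
qed (simp_all add: matrix_vector_mult_add_rdistrib matrix_vector_right_distrib
    scaleR_matrix_vector_assoc matrix_scaleR_vector_ac)

text \<open>Any Jacobian candidate with the right bounds will do; this avoids computing the three suprema
  for the explicit flows.\<close>

lemma holder_spaceI:
  assumes D: "\<And>x. (f has_derivative (\<lambda>y. J x *v y)) (at x)"
    and A: "\<And>x. norm (f x) \<le> A" and B: "\<And>x. norm (J x) \<le> B"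
    and C: "\<And>x y. norm (J x - J y) \<le> C * dist x y powr s"
  shows "f \<in> holder_space s" and "holder_norm s f \<le> A + B + C"
proof -
  have J: "jacobian f (at x) = J x" for x
    by (rule jacobian_eqI[OF D])
  show "f \<in> holder_space s"
    unfolding holder_space_def J mem_Collect_eq
  proof (intro conjI allI exI)
    show "f differentiable (at x)" for x
      using D differentiable_def by blast
    show "bounded (range f)" "bounded (range J)"
      using A B unfolding bounded_iff by auto
  qed (rule C)
  have "(SUP x. norm (f x)) \<le> A" "(SUP x. norm (J x)) \<le> B"
    by (auto intro!: cSUP_least A B)
  moreover have "(SUP (x, y) \<in> {(x, y). x \<noteq> y}. norm (J x - J y) / dist x y powr s) \<le> C"
  proof (rule cSUP_least)
    show "{(x::real^3, y). x \<noteq> y} \<noteq> {}"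
      using zero_neq_one by blast
  qed (auto simp: divide_le_eq C)
  ultimately show "holder_norm s f \<le> A + B + C"
    unfolding holder_norm_def J by linarith
qed

lemma holder_space_bounds:
  assumes "f \<in> holder_space s"
  shows "norm (f x) \<le> holder_norm s f"
    and "norm (jacobian f (at x)) \<le> holder_norm s f"
    and "norm (jacobian f (at x) - jacobian f (at y)) \<le> holder_norm s f * dist x y powr s"
proof -
  let ?J = "\<lambda>x. jacobian f (at x)" and ?P = "{(x::real^3, y). x \<noteq> y}"
  let ?q = "\<lambda>x y. norm (?J x - ?J y) / dist x y powr s"
  obtain C where C: "\<And>x y. norm (?J x - ?J y) \<le> C * dist x y powr s"
    using assms unfolding holder_space_def by auto
  have bdd: "bdd_above (range (\<lambda>x. norm (f x)))" "bdd_above (range (\<lambda>x. norm (?J x)))"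
    using assms unfolding holder_space_def by (auto intro!: bounded_imp_bdd_above simp: bounded_norm_comp)
  have bddP: "bdd_above ((\<lambda>(x, y). ?q x y) ` ?P)"
    by (rule bdd_aboveI[of _ C]) (auto simp: divide_le_eq C)
  have a: "norm (f x) \<le> (SUP x. norm (f x))" for x
    by (rule cSUP_upper) (auto intro: bdd)
  have b: "norm (?J x) \<le> (SUP x. norm (?J x))" for x
    by (rule cSUP_upper) (auto intro: bdd)
  have c: "?q x y \<le> (SUP (x, y) \<in> ?P. ?q x y)" if "x \<noteq> y" for x y
    using cSUP_upper[OF _ bddP, of "(x, y)"] that by auto
  have a0: "0 \<le> (SUP x. norm (f x))" and b0: "0 \<le> (SUP x. norm (?J x))"
    using order_trans[OF norm_ge_zero a] order_trans[OF norm_ge_zero b] by blast+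
  have c0: "0 \<le> (SUP (x, y) \<in> ?P. ?q x y)"
    using c[of 0 1] by (smt (verit) divide_nonneg_nonneg norm_ge_zero powr_ge_zero zero_neq_one)
  note N = holder_norm_def[of s f]
  show "norm (f x) \<le> holder_norm s f"
    using a[of x] b0 c0 N by linarith
  show "norm (jacobian f (at x)) \<le> holder_norm s f"
    using b[of x] a0 c0 N by linarith
  show "norm (?J x - ?J y) \<le> holder_norm s f * dist x y powr s"
  proof (cases "x = y")
    case False
    have "?q x y \<le> holder_norm s f"
      using c[OF False] a0 b0 N by linarith
    then show ?thesis
      using False by (simp add: divide_le_eq)
  qed simp
qed

lemma diff_diff_swap: "(a - b) - (c - d) = (a - c) - (b - d)" for a :: "'a :: ab_group_add"
  by (simp add: algebra_simps)

lemma holder_space_diff: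
  assumes "f \<in> holder_space s" and "g \<in> holder_space s"
  shows "(\<lambda>x. f x - g x) \<in> holder_space s"
proof (rule holder_spaceI(1))
  let ?J = "\<lambda>x. jacobian f (at x) - jacobian g (at x)"
  fix x y
  have d: "f differentiable (at x)" "g differentiable (at x)"
    using assms unfolding holder_space_def by auto
  then have "(\<lambda>x. f x - g x) differentiable (at x)"
    by (rule differentiable_diff)
  then show "((\<lambda>x. f x - g x) has_derivative (*v) (?J x)) (at x)"
    unfolding jacobian_works jacobian_diff[OF d] .
  show "norm (f x - g x) \<le> holder_norm s f + holder_norm s g"
    "norm (?J x) \<le> holder_norm s f + holder_norm s g"
    by (rule norm_triangle_le_diff; intro add_mono holder_space_bounds assms)+
  have "norm (?J x - ?J y) \<le> norm (jacobian f (at x) - jacobian f (at y))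
      + norm (jacobian g (at x) - jacobian g (at y))"
    by (subst diff_diff_swap) (rule norm_triangle_ineq4)
  also have "\<dots> \<le> (holder_norm s f + holder_norm s g) * dist x y powr s"
    unfolding distrib_right by (intro add_mono holder_space_bounds assms)
  finally show "norm (?J x - ?J y) \<le> (holder_norm s f + holder_norm s g) * dist x y powr s" .
qed

lemma holder_dist_bounds:
  assumes "f \<in> holder_space s" and "g \<in> holder_space s"
  shows "norm (f x - g x) \<le> holder_dist s f g"
    and "norm (jacobian f (at x) - jacobian g (at x)) \<le> holder_dist s f g"
    and "norm ((jacobian f (at x) - jacobian g (at x)) - (jacobian f (at y) - jacobian g (at y)))
      \<le> holder_dist s f g * dist x y powr s"
proof -
  have J: "jacobian (\<lambda>x. f x - g x) (at x) = jacobian f (at x) - jacobian g (at x)" for x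
    using assms unfolding holder_space_def by (intro jacobian_diff) auto
  note bounds = holder_space_bounds[OF holder_space_diff[OF assms], folded holder_dist_def, unfolded J]
  show "norm (f x - g x) \<le> holder_dist s f g"
    by (rule bounds(1))
  show "norm (jacobian f (at x) - jacobian g (at x)) \<le> holder_dist s f g"
    by (rule bounds(2))
  show "norm ((jacobian f (at x) - jacobian g (at x)) - (jacobian f (at y) - jacobian g (at y)))
      \<le> holder_dist s f g * dist x y powr s"
    by (rule bounds(3))
qed

text \<open>Mean value inequality: the operator norm of the Jacobian is below its Euclidean norm.\<close>

lemma holder_space_lipschitz:
  assumes "f \<in> holder_space s"
  shows "norm (f x - f y) \<le> holder_norm s f * dist x y"
proof -
  have D: "(f has_derivative (*v) (jacobian f (at x))) (at x)" for x
    using assms jacobian_works unfolding holder_space_def by blast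
  have O: "onorm ((*v) (jacobian f (at x))) \<le> holder_norm s f" for x
  proof (rule onorm_le)
    fix y
    show "norm (jacobian f (at x) *v y) \<le> holder_norm s f * norm y"
      by (rule order_trans[OF norm_matrix_vector_mult_le])
        (intro mult_right_mono holder_space_bounds assms norm_ge_zero)
  qed
  show ?thesis
    unfolding dist_norm
    by (rule differentiable_bound[OF convex_UNIV D O UNIV_I UNIV_I])
qed

text \<open>A constant field has vanishing Jacobian, so only the supremum norm sees it. The case \<open>c = 0\<close>
  also shows that the distance of a field from itself does not exceed 0.\<close>

lemma holder_dist_const: "holder_dist s (\<lambda>x. f x + c) f \<le> norm c"
proof -
  have "holder_norm s (\<lambda>x. c) \<le> norm c + 0 + 0"
    by (rule holder_spaceI(2)[where J = "\<lambda>x. 0"]) (auto)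
  then show ?thesis unfolding holder_dist_def by simp
qed


section \<open>A bounded profile whose derivative has a cusp\<close>

text \<open>Divide by \<open>(x + y)\<^sup>a\<close>: numbers \<open>z\<close> in the unit interval satisfy \<open>z \<le> z\<^sup>a\<close>, and the
  two fractions add up to 1.\<close>

lemma powr_add_le:
  fixes x y a :: real
  assumes "0 \<le> x" and "0 \<le> y" and "0 < a" and "a \<le> 1"
  shows "(x + y) powr a \<le> x powr a + y powr a"
proof (cases "x + y = 0")
  case False
  then have pos: "0 < x + y" using assms by linarith
  have le: "z / (x + y) \<le> (z / (x + y)) powr a" if "0 \<le> z" "z \<le> x + y" for z
    using powr_mono'[of a 1 "z / (x + y)"] that assms pos by (simp add: divide_le_eq)
  have "1 = x / (x + y) + y / (x + y)"
    using pos by (simp flip: add_divide_distrib)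
  also have "\<dots> \<le> (x / (x + y)) powr a + (y / (x + y)) powr a"
    using assms by (intro add_mono le) auto
  also have "\<dots> = (x powr a + y powr a) / (x + y) powr a"
    using assms pos by (simp add: powr_divide add_divide_distrib)
  finally show ?thesis
    using pos by (simp add: le_divide_eq)
qed (use assms in simp)

lemma abs_powr_diff_le:
  fixes x y a :: real
  assumes "0 \<le> x" and "0 \<le> y" and "0 < a" and "a \<le> 1"
  shows "\<bar>x powr a - y powr a\<bar> \<le> \<bar>x - y\<bar> powr a"
proof -
  have *: "\<bar>u powr a - v powr a\<bar> \<le> \<bar>u - v\<bar> powr a" if "0 \<le> v" "v \<le> u" for u v :: real
    using powr_add_le[of "u - v" v a] powr_mono2[of a v u] that assms by simp
  show ?thesis
    using *[of x y] *[of y x] assms by (cases "x \<le> y") (auto simp: abs_minus_commute)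
qed

lemma has_real_derivative_signed_powr:
  fixes a y :: real
  assumes "0 < a"
  shows "((\<lambda>x. x * \<bar>x\<bar> powr a) has_real_derivative (1 + a) * \<bar>y\<bar> powr a) (at y)"
proof (cases y "0 :: real" rule: linorder_cases)
  case greater
  have "((\<lambda>x. x * x powr a) has_real_derivative (1 + a) * y powr a) (at y)"
    using greater powr_mult_base[of y "a - 1"]
    by (auto intro!: derivative_eq_intros simp: algebra_simps)
  then have "((\<lambda>x. x * x powr a) has_real_derivative (1 + a) * \<bar>y\<bar> powr a) (at y)"
    using greater by simp
  then show ?thesis
    by (rule has_field_derivative_transform_within_open[of _ _ _ "{0<..}"]) (use greater in auto)
next
  case less
  have "((\<lambda>x. x * (- x) powr a) has_real_derivative (1 + a) * (- y) powr a) (at y)"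
  proof -
    have "y * (- y) powr (a - 1) = - ((- y) powr a)"
      using less powr_mult_base[of "- y" "a - 1"] by simp
    then show ?thesis
      using less by (auto intro!: derivative_eq_intros simp: algebra_simps)
  qed
  then have "((\<lambda>x. x * (- x) powr a) has_real_derivative (1 + a) * \<bar>y\<bar> powr a) (at y)"
    using less by simp
  then show ?thesis
    by (rule has_field_derivative_transform_within_open[of _ _ _ "{..<0}"]) (use less in auto)
next
  case equal
  have "((\<lambda>x::real. \<bar>x\<bar> powr a) \<longlongrightarrow> 0) (at 0)"
    using assms by (intro tendsto_zero_powrI tendsto_rabs_zero tendsto_const) auto
  then have "((\<lambda>x::real. (x * \<bar>x\<bar> powr a - 0 * \<bar>0\<bar> powr a) / (x - 0)) \<longlongrightarrow> 0) (at 0)"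
    by (rule filterlim_cong[THEN iffD1, rotated -1])
      (auto simp: eventually_at_filter)
  then show ?thesis
    using equal unfolding has_field_derivative_iff by simp
qed

text \<open>The sine makes \<open>y \<bar>y\<bar>\<^sup>a\<close> bounded without changing its behaviour at 0, and being Lipschitz
  it keeps the derivative Hoelder continuous with one constant on the whole line.\<close>

definition cusp :: "real \<Rightarrow> real \<Rightarrow> real" where
  "cusp a x = sin x * \<bar>sin x\<bar> powr a"

definition cusp_deriv :: "real \<Rightarrow> real \<Rightarrow> real" where
  "cusp_deriv a x = (1 + a) * \<bar>sin x\<bar> powr a * cos x"

lemma cusp_has_derivative:
  "0 < a \<Longrightarrow> (cusp a has_real_derivative cusp_deriv a x) (at x)"
  unfolding cusp_def cusp_deriv_def
  by (rule DERIV_chain2[OF has_real_derivative_signed_powr DERIV_sin])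

lemma abs_cusp_le: "0 < a \<Longrightarrow> \<bar>cusp a x\<bar> \<le> 1"
  unfolding cusp_def abs_mult
  by (intro mult_le_one) (auto intro: powr_le1)

lemma abs_cusp_deriv_le: "0 < a \<Longrightarrow> a \<le> 1 \<Longrightarrow> \<bar>cusp_deriv a x\<bar> \<le> 2"
proof -
  assume a: "0 < a" "a \<le> 1"
  have "\<bar>sin x\<bar> powr a * \<bar>cos x\<bar> \<le> 1"
    using a by (intro mult_le_one) (auto intro: powr_le1)
  then have "(1 + a) * (\<bar>sin x\<bar> powr a * \<bar>cos x\<bar>) \<le> 2 * 1"
    using a by (intro mult_mono) auto
  then show ?thesis
    using a by (simp add: cusp_deriv_def abs_mult mult.assoc)
qed

lemma abs_sin_diff_le: "\<bar>sin x - sin y\<bar> \<le> \<bar>x - y\<bar>" for x y :: real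
proof -
  have "\<bar>sin x - sin y\<bar> = 2 * \<bar>sin ((x - y) / 2)\<bar> * \<bar>cos ((x + y) / 2)\<bar>"
    by (simp add: sin_diff_sin abs_mult)
  also have "\<dots> \<le> 2 * \<bar>(x - y) / 2\<bar> * 1"
    by (intro mult_mono mult_left_mono abs_sin_x_le_abs_x) auto
  finally show ?thesis by simp
qed

lemma abs_cos_diff_le_powr:
  fixes x y a :: real
  assumes "0 < a" and "a \<le> 1"
  shows "\<bar>cos x - cos y\<bar> \<le> 2 * \<bar>x - y\<bar> powr a"
proof (cases "\<bar>x - y\<bar> \<le> 1")
  case True
  have "\<bar>cos x - cos y\<bar> = 2 * \<bar>sin ((x + y) / 2)\<bar> * \<bar>sin ((y - x) / 2)\<bar>"
    by (simp add: cos_diff_cos abs_mult)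
  also have "\<dots> \<le> 2 * 1 * \<bar>(y - x) / 2\<bar>"
    by (intro mult_mono mult_left_mono abs_sin_x_le_abs_x) auto
  also have "\<dots> \<le> \<bar>x - y\<bar> powr a"
    using powr_mono'[of a 1 "\<bar>x - y\<bar>"] True assms by simp
  finally show ?thesis by (smt (verit) powr_ge_zero)
next
  case False
  have "\<bar>cos x - cos y\<bar> \<le> 2"
    using cos_ge_minus_one[of x] cos_ge_minus_one[of y] cos_le_one[of x] cos_le_one[of y]
    by linarith
  moreover have "1 \<le> \<bar>x - y\<bar> powr a"
    using False assms by (intro ge_one_powr_ge_zero) auto
  ultimately show ?thesis by linarith
qed

lemma cusp_deriv_holder:
  assumes "0 < a" and "a \<le> 1"
  shows "\<bar>cusp_deriv a x - cusp_deriv a y\<bar> \<le> 6 * \<bar>x - y\<bar> powr a"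
proof -
  let ?p = "\<lambda>x. \<bar>sin x\<bar> powr a"
  have "\<bar>?p x - ?p y\<bar> \<le> \<bar>\<bar>sin x\<bar> - \<bar>sin y\<bar>\<bar> powr a"
    using assms by (intro abs_powr_diff_le) auto
  also have "\<dots> \<le> \<bar>x - y\<bar> powr a"
    using assms abs_sin_diff_le[of x y] by (intro powr_mono2) auto
  finally have p: "\<bar>?p x - ?p y\<bar> \<le> \<bar>x - y\<bar> powr a" .
  have "?p x * cos x - ?p y * cos y = (?p x - ?p y) * cos x + ?p y * (cos x - cos y)"
    by (simp add: algebra_simps)
  also have "\<bar>\<dots>\<bar> \<le> \<bar>?p x - ?p y\<bar> * \<bar>cos x\<bar> + ?p y * \<bar>cos x - cos y\<bar>"
    by (rule order_trans[OF abs_triangle_ineq]) (simp add: abs_mult)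
  also have "\<dots> \<le> \<bar>x - y\<bar> powr a * 1 + 1 * (2 * \<bar>x - y\<bar> powr a)"
    using assms
    by (intro add_mono mult_mono p abs_cos_diff_le_powr) (auto intro: powr_le1)
  finally have "(1 + a) * \<bar>?p x * cos x - ?p y * cos y\<bar> \<le> 2 * (3 * \<bar>x - y\<bar> powr a)"
    using assms by (intro mult_mono) auto
  moreover have "\<bar>cusp_deriv a x - cusp_deriv a y\<bar> = (1 + a) * \<bar>?p x * cos x - ?p y * cos y\<bar>"
    using assms by (simp add: cusp_deriv_def abs_mult mult.assoc flip: right_diff_distrib)
  ultimately show ?thesis by simp
qed

lemma cusp_deriv_0 [simp]: "0 < a \<Longrightarrow> cusp_deriv a 0 = 0"
  by (simp add: cusp_deriv_def)

lemma cusp_deriv_minus [simp]: "cusp_deriv a (- x) = cusp_deriv a x"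
  by (simp add: cusp_deriv_def)

text \<open>The cusp itself: on \<open>(0, 1]\<close> both \<open>cos\<close> and \<open>sin x / x\<close> are at least 1/2.\<close>

lemma cusp_deriv_ge:
  assumes a: "0 < a" "a \<le> 1" and x: "0 < x" "x \<le> 1"
  shows "x powr a / 4 \<le> cusp_deriv a x"
proof -
  have cos: "1 / 2 \<le> cos y" if "0 \<le> y" "y \<le> 1" for y :: real
  proof -
    have "cos (pi / 3) \<le> cos y"
      using that pi_gt3 by (intro cos_monotone_0_pi_le) auto
    then show ?thesis by (simp add: cos_60)
  qed
  obtain z where z: "0 < z" "z < x" "sin x - sin 0 = (x - 0) * cos z"
    using MVT2[of 0 x sin cos] x by (auto intro: DERIV_sin)
  then have s: "x / 2 \<le> sin x"
    using cos[of z] x mult_left_mono[of "1 / 2" "cos z" x] by simp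
  have "x powr a / 4 = x powr a * (1 / 2) * (1 / 2)" by simp
  also have "\<dots> \<le> x powr a * (1 / 2) powr a * (1 / 2)"
    using powr_mono'[of a 1 "1 / 2"] a by (intro mult_mono mult_left_mono) auto
  also have "\<dots> = (x / 2) powr a * (1 / 2)"
    using x by (simp flip: powr_mult)
  also have "\<dots> \<le> \<bar>sin x\<bar> powr a * cos x"
    using s x a cos[of x] by (intro mult_mono powr_mono2) auto
  also have "\<dots> \<le> cusp_deriv a x"
    using a cos[of x] x by (auto simp: cusp_deriv_def mult.assoc intro!: mult_right_le_one_le
      mult_right_mono[of 1 "1 + a", simplified])
  finally show ?thesis .
qed

section \<open>Shear flows\<close>

definition shear :: "real \<Rightarrow> (real \<Rightarrow> real) \<Rightarrow> vfield" where
  "shear c h x = c *\<^sub>R axis 1 1 + h (x $ 1) *\<^sub>R axis 3 1"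

text \<open>\<^term>\<open>axis 3 (axis 1 1)\<close> is the matrix unit in row 3 and column 1.\<close>

lemma axis_matrix_vector_mult:
  "(axis 3 (axis 1 1) :: real^3^3) *v y = y $ 1 *\<^sub>R axis 3 1"
  by (simp add: vec_eq_iff forall_3 matrix_vector_mult_def sum_3 axis_def)

lemma norm_axis: "norm (axis i x) = norm x" for x :: "'a :: real_normed_vector"
proof -
  have "(\<Sum>j\<in>UNIV. (norm (axis i x $ j))\<^sup>2) = (\<Sum>j\<in>UNIV. if j = i then (norm x)\<^sup>2 else 0)"
    by (intro sum.cong) (auto simp: axis_def)
  then show ?thesis
    by (simp add: norm_vec_def L2_set_def)
qed

lemma shear_has_derivative:
  assumes "\<And>y. (h has_real_derivative h' y) (at y)"
  shows "(shear c h has_derivative (*v) (h' (x $ 1) *\<^sub>R axis 3 (axis 1 1))) (at x)"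
proof -
  have "((\<lambda>x::real^3. h (x $ 1)) has_derivative (\<lambda>y. h' (x $ 1) * y $ 1)) (at x)"
    using assms[unfolded has_field_derivative_def]
    by (rule has_derivative_compose[OF bounded_linear_imp_has_derivative[OF bounded_linear_vec_nth]])
  then have "(shear c h has_derivative (\<lambda>y. 0 + (h' (x $ 1) * y $ 1) *\<^sub>R axis 3 1)) (at x)"
    unfolding shear_def[abs_def]
    by (intro has_derivative_add has_derivative_const has_derivative_scaleR_left)
  moreover have "(*v) (h' (x $ 1) *\<^sub>R axis 3 (axis 1 1) :: real^3^3) = (\<lambda>y. 0 + (h' (x $ 1) * y $ 1) *\<^sub>R axis 3 1)"
    by (simp add: fun_eq_iff axis_matrix_vector_mult flip: scaleR_matrix_vector_assoc)
  ultimately show ?thesis by metis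
qed

lemmas jacobian_shear = jacobian_eqI[OF shear_has_derivative]

text \<open>The bound on the norm depends on the profile only through bounds that are invariant under
  translation, hence is uniform in time along a shear flow.\<close>

lemma shear_holder_space:
  assumes D: "\<And>y. (h has_real_derivative h' y) (at y)"
    and A: "\<And>y. \<bar>h y\<bar> \<le> A" and B: "\<And>y. \<bar>h' y\<bar> \<le> B"
    and C: "\<And>x y. \<bar>h' x - h' y\<bar> \<le> C * \<bar>x - y\<bar> powr s" and s: "0 < s"
  shows "shear c h \<in> initial_data s" and "holder_norm s (shear c h) \<le> (\<bar>c\<bar> + A) + B + C"
proof -
  have C0: "0 \<le> C"
    using C[of 0 1] by (auto intro: order_trans[OF abs_ge_zero])
  have *: "norm (shear c h x) \<le> \<bar>c\<bar> + A" for x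
    unfolding shear_def using A[of "x $ 1"]
    by (intro order_trans[OF norm_triangle_ineq]) (simp add: norm_axis)
  have **: "norm (h' (x $ 1) *\<^sub>R axis 3 (axis 1 1 :: real^3) - h' (y $ 1) *\<^sub>R axis 3 (axis 1 1) :: real^3^3)
      \<le> C * dist x y powr s" for x y :: "real^3"
  proof -
    have "\<bar>x $ 1 - y $ 1\<bar> \<le> dist x y"
      by (metis component_le_norm_cart dist_norm vector_minus_component)
    then have "C * \<bar>x $ 1 - y $ 1\<bar> powr s \<le> C * dist x y powr s"
      using s C0 by (intro mult_left_mono powr_mono2) auto
    then show ?thesis
      using C[of "x $ 1" "y $ 1"] by (simp add: norm_axis flip: scaleR_diff_left)
  qed
  have ***: "norm (h' (x $ 1) *\<^sub>R axis 3 (axis 1 1) :: real^3^3) \<le> B" for x :: "real^3"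
    using B by (simp add: norm_axis)
  note I = holder_spaceI[where f = "shear c h", OF shear_has_derivative[OF D] * *** **]
  show "holder_norm s (shear c h) \<le> (\<bar>c\<bar> + A) + B + C"
    by (rule I(2))
  have "divergence (shear c h) x = 0" for x
    unfolding divergence_def jacobian_shear[OF D] by (simp add: trace_def sum_3 axis_def)
  then show "shear c h \<in> initial_data s"
    unfolding initial_data_def using I(1) by simp
qed

text \<open>The first component \<open>c\<close> of the velocity only transports the third one, which is constant in the
  directions of \<open>x\<^sub>2\<close> and \<open>x\<^sub>3\<close>; no pressure is created.\<close>

lemma euler_solution_shear:
  assumes D: "\<And>y. (h has_real_derivative h' y) (at y)"
    and A: "\<And>y. \<bar>h y\<bar> \<le> A" and B: "\<And>y. \<bar>h' y\<bar> \<le> B"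
    and C: "\<And>x y. \<bar>h' x - h' y\<bar> \<le> C * \<bar>x - y\<bar> powr s" and s: "0 < s"
  shows "euler_solution s T (shear c h) (\<lambda>t. shear c (\<lambda>y. h (y - c * t)))"
proof -
  let ?u = "\<lambda>t. shear c (\<lambda>y. h (y - c * t))"
  have D': "((\<lambda>y. h (y - c * t)) has_real_derivative h' (y - c * t)) (at y)" for t y
    using DERIV_chain2[OF D DERIV_diff[OF DERIV_ident DERIV_const]] by simp
  have data: "?u t \<in> initial_data s" and N: "holder_norm s (?u t) \<le> (\<bar>c\<bar> + A) + B + C" for t
    using shear_holder_space[OF D' A B _ s, of t C c] C[of "_ - c * t" "_ - c * t"] by auto
  have N': "\<bar>holder_norm s (?u t)\<bar> \<le> (\<bar>c\<bar> + A) + B + C" for t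
    using N[of t] order_trans[OF norm_ge_zero holder_space_bounds(1)] data[of t]
    unfolding initial_data_def by fastforce
  have E: "((\<lambda>r. ?u r x) has_vector_derivative
      - (jacobian (?u t) (at x) *v ?u t x) - 0) (at t within {0..<T})" for t x
  proof -
    have "((\<lambda>r. h (x $ 1 - c * r)) has_vector_derivative - c * h' (x $ 1 - c * t)) (at t within {0..<T})"
    proof -
      have "((\<lambda>r. x $ 1 - c * r) has_real_derivative - c) (at t within {0..<T})"
        by (auto intro!: derivative_eq_intros)
      from DERIV_chain2[OF D this] show ?thesis
        by (simp add: has_real_derivative_iff_has_vector_derivative mult.commute)
    qed
    then have "((\<lambda>r. ?u r x) has_vector_derivative 0 + (- c * h' (x $ 1 - c * t)) *\<^sub>R axis 3 1)
        (at t within {0..<T})"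
      unfolding shear_def
      by (intro has_vector_derivative_add has_vector_derivative_const
          bounded_linear.has_vector_derivative[OF bounded_linear_scaleR_left])
    moreover have "jacobian (?u t) (at x) *v ?u t x = (c * h' (x $ 1 - c * t)) *\<^sub>R axis 3 1"
      unfolding jacobian_shear[OF D'] scaleR_matrix_vector_assoc[symmetric] axis_matrix_vector_mult
      by (simp add: shear_def axis_def)
    ultimately show ?thesis by simp
  qed
  show ?thesis
    unfolding euler_solution_def
  proof (intro conjI ballI allI)
    show "bounded ((\<lambda>t. holder_norm s (?u t)) ` {0..\<tau>})" for \<tau>
      unfolding bounded_iff using N' by auto
    show "\<exists>p G. (\<forall>t\<in>{0..<T}. \<forall>x. GDERIV (p t) x :> G t x) \<and>
        continuous_on ({0..<T} \<times> UNIV) (\<lambda>(t, x). G t x) \<and>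
        (\<forall>t\<in>{0..<T}. ((\<lambda>x. p t x / norm x) \<longlongrightarrow> 0) at_infinity) \<and>
        (\<forall>t\<in>{0..<T}. \<forall>x. ((\<lambda>r. ?u r x) has_vector_derivative
           - (jacobian (?u t) (at x) *v ?u t x) - G t x) (at t within {0..<T}))"
      by (rule exI[of _ "\<lambda>t x. 0"], rule exI[of _ "\<lambda>t x. 0"])
        (use E in \<open>auto simp: GDERIV_const split_beta\<close>)
  qed (use data in \<open>auto simp: initial_data_def\<close>)
qed


section \<open>Circulation around a square\<close>

definition plane_point :: "real \<Rightarrow> real \<Rightarrow> real^3" where
  "plane_point a b = a *\<^sub>R axis 1 1 + b *\<^sub>R axis 3 1"

text \<open>The line integral of \<open>w\<close> along the boundary of the square \<open>[0,d] \<times> [0,d]\<close> in the plane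
  \<open>x\<^sub>2 = 0\<close>. Opposite sides are paired pointwise, so that only differences of \<open>w\<close> over the distance
  \<open>d\<close> occur.\<close>

definition circulation :: "real \<Rightarrow> vfield \<Rightarrow> real" where
  "circulation d w = integral {0..d} (\<lambda>s. (w (plane_point s 0) - w (plane_point s d)) $ 1 + (w (plane_point d s) - w (plane_point 0 s)) $ 3)"

lemma dist_plane_point: "dist (plane_point a b) (plane_point a b') = \<bar>b - b'\<bar>" "dist (plane_point a b) (plane_point a' b) = \<bar>a - a'\<bar>"
  by (simp_all add: plane_point_def dist_norm flip: scaleR_diff_left)

lemma plane_point_nth [simp]: "plane_point a b $ 1 = a" "plane_point a b $ 3 = b"
  by (simp_all add: plane_point_def axis_def)

lemma continuous_on_plane_point [continuous_intros]:
  "continuous_on S f \<Longrightarrow> continuous_on S g \<Longrightarrow> continuous_on S (\<lambda>x. plane_point (f x) (g x))"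
  unfolding plane_point_def by (intro continuous_intros)

lemma continuous_on_circulation_integrand:
  fixes w :: vfield
  assumes "continuous_on UNIV w"
  shows "continuous_on S (\<lambda>s. (w (plane_point s 0) - w (plane_point s d)) $ 1 + (w (plane_point d s) - w (plane_point 0 s)) $ 3)"
proof -
  have "continuous_on S (\<lambda>s. w (plane_point (f s) (g s)))" if "continuous_on S f" "continuous_on S g" for f g
    by (rule continuous_on_compose2[OF assms continuous_on_plane_point]) (use that in auto)
  then show ?thesis by (intro continuous_intros) (simp_all add: continuous_on_id)
qed

lemmas circulation_integrable = integrable_continuous_real[OF continuous_on_circulation_integrand]

lemma circulation_diff:
  assumes "continuous_on UNIV v" and "continuous_on UNIV w"
  shows "circulation d (\<lambda>x. v x - w x) = circulation d v - circulation d w"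
  unfolding circulation_def
  by (subst integral_diff[OF circulation_integrable circulation_integrable, OF assms, symmetric])
    (simp add: algebra_simps)

text \<open>A modulus of continuity of \<open>w\<close> gains over the trivial bound; this is applied once with a
  Hoelder and once with a Lipschitz modulus.\<close>

lemma abs_circulation_le:
  assumes w: "continuous_on UNIV w" and d: "0 \<le> d"
    and B: "\<And>x y. dist x y = d \<Longrightarrow> norm (w x - w y) \<le> B"
  shows "\<bar>circulation d w\<bar> \<le> 2 * B * d"
proof -
  have *: "\<bar>(w x - w y) $ i\<bar> \<le> B" if "dist x y = d" for x y i
    using B[OF that] component_le_norm_cart order_trans by blast
  have "norm (circulation d w) \<le> (2 * B) * (d - 0)"
    unfolding circulation_def
  proof (rule integral_bound[OF d])
    show "continuous_on {0..d} (\<lambda>s. (w (plane_point s 0) - w (plane_point s d)) $ 1 + (w (plane_point d s) - w (plane_point 0 s)) $ 3)"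
      by (rule continuous_on_circulation_integrand[OF w])
    fix s
    have "\<bar>(w (plane_point s 0) - w (plane_point s d)) $ 1\<bar> \<le> B" "\<bar>(w (plane_point d s) - w (plane_point 0 s)) $ 3\<bar> \<le> B"
      using d by (intro *; simp add: dist_plane_point)+
    then show "norm ((w (plane_point s 0) - w (plane_point s d)) $ 1 + (w (plane_point d s) - w (plane_point 0 s)) $ 3) \<le> 2 * B"
      by simp
  qed
  then show ?thesis by simp
qed

text \<open>Each side contributes the difference of \<open>p\<close> between two corners. The fundamental theorem of
  calculus for the gauge integral also yields integrability.\<close>

lemma circulation_gradient:
  assumes p: "\<And>x. GDERIV p x :> G x" and d: "0 \<le> d"
  shows "circulation d G = 0"
proof -
  have p': "(p has_derivative (\<lambda>y. y \<bullet> G x)) (at x)" for x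
    using p unfolding gderiv_def .
  have h: "((\<lambda>s. G (plane_point s b) $ 1) has_integral p (plane_point d b) - p (plane_point 0 b)) {0..d}" for b
  proof (rule fundamental_theorem_of_calculus[OF d])
    fix s
    have "((\<lambda>s. plane_point s b) has_derivative (\<lambda>r. r *\<^sub>R axis 1 1)) (at s within {0..d})"
      unfolding plane_point_def by (auto intro!: derivative_eq_intros)
    from has_derivative_compose[OF this p']
    show "((\<lambda>s. p (plane_point s b)) has_vector_derivative G (plane_point s b) $ 1) (at s within {0..d})"
      by (simp add: has_vector_derivative_def inner_axis')
  qed
  have v: "((\<lambda>s. G (plane_point a s) $ 3) has_integral p (plane_point a d) - p (plane_point a 0)) {0..d}" for a
  proof (rule fundamental_theorem_of_calculus[OF d])
    fix s
    have "((\<lambda>s. plane_point a s) has_derivative (\<lambda>r. r *\<^sub>R axis 3 1)) (at s within {0..d})"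
      unfolding plane_point_def by (auto intro!: derivative_eq_intros)
    from has_derivative_compose[OF this p']
    show "((\<lambda>s. p (plane_point a s)) has_vector_derivative G (plane_point a s) $ 3) (at s within {0..d})"
      by (simp add: has_vector_derivative_def inner_axis')
  qed
  show ?thesis
    unfolding circulation_def
    using integral_unique[OF has_integral_add[OF has_integral_diff[OF h[of 0] h[of d]]
        has_integral_diff[OF v[of d] v[of 0]]]]
    by simp
qed

lemma circulation_has_derivative:
  assumes u: "\<And>t x. t \<in> U \<Longrightarrow> ((\<lambda>r. u r x) has_vector_derivative W t x) (at t within U)"
    and cont_u: "\<And>t. t \<in> U \<Longrightarrow> continuous_on UNIV (u t)"
    and cont_W: "continuous_on (U \<times> UNIV) (\<lambda>(t, x). W t x)"
    and U: "convex U" "t \<in> U"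
  shows "((\<lambda>r. circulation d (u r)) has_vector_derivative circulation d (W t)) (at t within U)"
  unfolding circulation_def cbox_interval[symmetric]
proof (rule leibniz_rule_vector_derivative[OF _ _ _ U(2,1)])
  have nth: "((\<lambda>r. u r x $ i) has_vector_derivative W t x $ i) (at t within U)"
    if "t \<in> U" for t x i
    by (rule bounded_linear.has_vector_derivative[OF bounded_linear_vec_nth u[OF that]])
  fix r s assume "r \<in> U"
  then show "((\<lambda>r. (u r (plane_point s 0) - u r (plane_point s d)) $ 1 + (u r (plane_point d s) - u r (plane_point 0 s)) $ 3)
      has_vector_derivative
      (W r (plane_point s 0) - W r (plane_point s d)) $ 1 + (W r (plane_point d s) - W r (plane_point 0 s)) $ 3) (at r within U)"
    unfolding vector_minus_component
    by (intro has_vector_derivative_add has_vector_derivative_diff nth)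
next
  fix r assume "r \<in> U"
  then show "(\<lambda>s. (u r (plane_point s 0) - u r (plane_point s d)) $ 1 + (u r (plane_point d s) - u r (plane_point 0 s)) $ 3)
      integrable_on cbox 0 d"
    unfolding cbox_interval by (intro circulation_integrable cont_u)
next
  have "continuous_on (U \<times> cbox 0 d) (\<lambda>z. W (fst z) (plane_point (f (snd z)) (g (snd z))))"
    if "continuous_on UNIV f" "continuous_on UNIV g" for f g
  proof -
    have "continuous_on (U \<times> cbox 0 d) (\<lambda>z. (fst z, plane_point (f (snd z)) (g (snd z))))"
      by (intro continuous_on_Pair continuous_on_plane_point continuous_on_compose2[OF that(1)]
          continuous_on_compose2[OF that(2)] continuous_on_fst continuous_on_snd continuous_on_id) auto
    from continuous_on_compose2[OF cont_W this] show ?thesis by (simp add: image_subset_iff)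
  qed
  note this[OF continuous_on_id continuous_on_const] this[OF continuous_on_const continuous_on_id]
  then show "continuous_on (U \<times> cbox 0 d)
      (\<lambda>(r, s). (W r (plane_point s 0) - W r (plane_point s d)) $ 1 + (W r (plane_point d s) - W r (plane_point 0 s)) $ 3)"
    unfolding split_beta by (intro continuous_intros)
qed

text \<open>The advection term of a shear flow has this form.\<close>

lemma circulation_profile:
  assumes "0 \<le> d"
  shows "circulation d (\<lambda>x. k (x $ 1) *\<^sub>R axis 3 1) = d * (k d - k 0)"
  using assms by (simp add: circulation_def axis_def)

section \<open>The advection term\<close>

text \<open>Continuity in \<open>t\<close> that is uniform in \<open>x\<close>, together with continuity in \<open>x\<close>, is joint continuity.
  For a Hoelder-continuous curve this justifies differentiation under the circulation integral.\<close>

lemma continuous_on_timesI: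
  fixes f :: "'a :: metric_space \<Rightarrow> 'b :: metric_space \<Rightarrow> 'c :: metric_space"
  assumes f: "\<And>t. t \<in> U \<Longrightarrow> continuous_on V (f t)"
    and d: "\<And>t. t \<in> U \<Longrightarrow> ((\<lambda>r. d r t) \<longlongrightarrow> 0) (at t within U)"
    and le: "\<And>r t x. r \<in> U \<Longrightarrow> t \<in> U \<Longrightarrow> x \<in> V \<Longrightarrow> dist (f r x) (f t x) \<le> d r t"
  shows "continuous_on (U \<times> V) (\<lambda>(t, x). f t x)"
  unfolding continuous_on_iff
proof (clarify, goal_cases)
  case (1 t x e)
  obtain d1 where d1: "0 < d1" "\<And>y. y \<in> V \<Longrightarrow> dist y x < d1 \<Longrightarrow> dist (f t y) (f t x) < e / 2"
    using f[OF 1(1)] 1(2,3) unfolding continuous_on_iff by (metis half_gt_zero)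
  obtain d2 where d2: "0 < d2" "\<And>r. r \<in> U \<Longrightarrow> r \<noteq> t \<Longrightarrow> dist r t < d2 \<Longrightarrow> d r t < e / 2"
    using order_tendstoD(2)[OF d[OF 1(1)], of "e / 2"] 1(3) unfolding eventually_at by auto
  show ?case
  proof (intro exI[of _ "min d1 d2"] conjI ballI impI, goal_cases)
    case 1 then show ?case using d1 d2 by simp
  next
    case (2 z)
    obtain r y where z: "z = (r, y)" "r \<in> U" "y \<in> V" using 2(1) by auto
    have "dist r t < d2" "dist y x < d1"
      using 2(2) dist_fst_le[of z "(t, x)"] dist_snd_le[of z "(t, x)"] z by auto
    then have "dist (f r y) (f t y) < e / 2" "dist (f t y) (f t x) < e / 2"
      using d1(2) d2(2)[of r] le[of r t y] z \<open>t \<in> U\<close> \<open>0 < e\<close> by (cases "r = t"; force)+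
    then have "dist (f r y) (f t x) < e"
      using dist_triangle[of "f r y" "f t x" "f t y"] by linarith
    then show ?case
      using z by simp
  qed
qed

definition advection :: "vfield \<Rightarrow> vfield" where
  "advection v x = jacobian v (at x) *v v x"

lemma advection_shear:
  assumes "\<And>y. (h has_real_derivative h' y) (at y)"
  shows "advection (shear c h) = (\<lambda>x. (c * h' (x $ 1)) *\<^sub>R axis 3 1)"
  unfolding advection_def jacobian_shear[OF assms] scaleR_matrix_vector_assoc[symmetric]
    axis_matrix_vector_mult
  by (simp add: shear_def axis_def fun_eq_iff)

lemma holder_space_continuous:
  assumes f: "f \<in> holder_space s" and s: "0 < s"
  shows "continuous_on UNIV f" and "continuous_on UNIV (\<lambda>x. jacobian f (at x))"
    and "continuous_on UNIV (advection f)"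
proof -
  show f': "continuous_on UNIV f"
    using f unfolding holder_space_def
    by (auto intro!: differentiable_imp_continuous_on simp: differentiable_on_def)
  show J: "continuous_on UNIV (\<lambda>x. jacobian f (at x))"
    unfolding continuous_on_def
  proof
    fix x :: "real^3"
    have "((\<lambda>y. dist y x) \<longlongrightarrow> 0) (at x)"
      using tendsto_dist_iff[of "\<lambda>y. y" x "at x"] by (simp add: tendsto_ident_at)
    then have "((\<lambda>y. dist y x powr s) \<longlongrightarrow> 0) (at x)"
      using s by (intro tendsto_zero_powrI tendsto_const) auto
    then have "((\<lambda>y. holder_norm s f * dist y x powr s) \<longlongrightarrow> 0) (at x)"
      by (rule tendsto_mult_right_zero)
    then have "((\<lambda>y. jacobian f (at y) - jacobian f (at x)) \<longlongrightarrow> 0) (at x)"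
      by (rule Lim_null_comparison[OF always_eventually, rotated])
        (rule allI, rule holder_space_bounds(3)[OF f])
    then show "((\<lambda>y. jacobian f (at y)) \<longlongrightarrow> jacobian f (at x)) (at x)"
      by (rule Lim_null[THEN iffD2])
  qed
  show "continuous_on UNIV (advection f)"
    unfolding advection_def[abs_def]
    using bounded_bilinear.continuous_on[OF bounded_bilinear_matrix_vector_mult J f'] .
qed

text \<open>Advection is continuous from the full Hoelder norm to the Hoelder seminorm of exponent \<open>s\<close>.
  With \<open>B\<close> the difference of the Jacobians and \<open>z\<close> that of the fields, \<open>advection f - advection g\<close>
  is \<open>B f + (Dg) z\<close>; the product rule for increments produces four terms of equal size.\<close>

lemma norm_advection_diff_le:
  assumes f: "f \<in> holder_space s" and g: "g \<in> holder_space s"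
    and K: "holder_norm s f \<le> K" "holder_norm s g \<le> K"
    and d: "dist x y \<le> 1" and s: "s \<le> 1"
  shows "norm ((advection f x - advection g x) - (advection f y - advection g y))
    \<le> 4 * K * holder_dist s f g * dist x y powr s"
proof -
  define e where "e = holder_dist s f g"
  define B where "B x = jacobian f (at x) - jacobian g (at x)" for x
  define z where "z x = f x - g x" for x
  have e0: "0 \<le> e"
    unfolding e_def by (rule order_trans[OF norm_ge_zero holder_dist_bounds(1)[OF f g]])
  have K0: "0 \<le> K"
    using order_trans[OF norm_ge_zero holder_space_bounds(1)[OF f]] K(1) by linarith
  let ?p = "dist x y powr s"
  have dp: "dist x y \<le> ?p"
    using powr_mono'[of s 1 "dist x y"] d s by simp
  have 1: "norm (B x - B y) \<le> e * ?p" "norm (B y) \<le> e" "norm (z x) \<le> e"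
    unfolding B_def z_def e_def by (rule holder_dist_bounds[OF f g])+
  have z: "norm (z x - z y) \<le> e * ?p"
    using holder_space_lipschitz[OF holder_space_diff[OF f g], of x y] mult_left_mono[OF dp e0]
    unfolding z_def e_def holder_dist_def by linarith
  have 2: "norm (f x) \<le> K" "norm (jacobian g (at y)) \<le> K"
    by (rule order_trans[OF holder_space_bounds(1)[OF f] K(1)]
        order_trans[OF holder_space_bounds(2)[OF g] K(2)])+
  have "norm (f x - f y) \<le> holder_norm s f * dist x y"
    by (rule holder_space_lipschitz[OF f])
  also have "\<dots> \<le> K * ?p"
    using K(1) K0 dp by (intro mult_mono) auto
  finally have f': "norm (f x - f y) \<le> K * ?p" .
  have "norm (jacobian g (at x) - jacobian g (at y)) \<le> holder_norm s g * ?p"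
    by (rule holder_space_bounds(3)[OF g])
  also have "\<dots> \<le> K * ?p"
    using K(2) by (intro mult_right_mono) auto
  finally have g': "norm (jacobian g (at x) - jacobian g (at y)) \<le> K * ?p" .
  have m: "norm (A *v v) \<le> a * b" if "norm A \<le> a" "norm v \<le> b" for A :: "real^3^3" and v a b
    using norm_matrix_vector_mult_le[of A v] mult_mono[OF that order_trans[OF norm_ge_zero that(1)]]
    by simp
  have "(advection f x - advection g x) - (advection f y - advection g y)
      = ((B x - B y) *v f x + B y *v (f x - f y))
        + ((jacobian g (at x) - jacobian g (at y)) *v z x + jacobian g (at y) *v (z x - z y))"
    unfolding advection_def B_def z_def
    by (simp add: matrix_vector_mult_diff_distrib matrix_vector_mult_diff_rdistrib)
  also have "norm \<dots> \<le> ((e * ?p) * K + e * (K * ?p)) + ((K * ?p) * e + K * (e * ?p))"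
    by (intro norm_triangle_mono m 1 2 z f' g')
  finally show ?thesis
    unfolding e_def by (simp add: algebra_simps)
qed


section \<open>Non-existence of Hoelder-continuous solutions\<close>

text \<open>As long as the velocity stays close to this datum in the Hoelder norm, conservation of momentum
  up to a gradient makes the circulation at scale \<open>d\<close> change at a rate of order \<open>d\<^bsup>1+s\<^esup>\<close>. The
  difference of two Lipschitz velocities has circulation of order \<open>d\<^sup>2\<close> only.\<close>

lemma no_hoelder_continuous_solution:
  assumes s: "0 < s" "s < 1" and T: "0 < T"
    and u: "u \<in> continuous_curves s T" and sol: "euler_solution s T (shear 1 (cusp s)) u"
  shows False
proof -
  let ?U = "{0..<T}"
  have H: "u t \<in> holder_space s" if "t \<in> ?U" for t
    using u that unfolding continuous_curves_def by auto
  have lim: "((\<lambda>r. holder_dist s (u r) (u t)) \<longlongrightarrow> 0) (at t within ?U)" if "t \<in> ?U" for t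
    using u that unfolding continuous_curves_def by auto
  have u0: "u 0 = shear 1 (cusp s)"
    using sol unfolding euler_solution_def by blast
  have "\<exists>p G. (\<forall>t\<in>?U. \<forall>x. GDERIV (p t) x :> G t x) \<and>
      continuous_on (?U \<times> UNIV) (\<lambda>(t, x). G t x) \<and>
      (\<forall>t\<in>?U. \<forall>x.
        ((\<lambda>r. u r x) has_vector_derivative - advection (u t) x - G t x) (at t within ?U))"
    using sol unfolding euler_solution_def advection_def by (elim conjE exE) (intro exI conjI)
  then obtain p G where p: "\<And>t x. t \<in> ?U \<Longrightarrow> GDERIV (p t) x :> G t x"
    and G: "continuous_on (?U \<times> UNIV) (\<lambda>(t, x). G t x)"
    and ode: "\<And>t x. t \<in> ?U \<Longrightarrow>
      ((\<lambda>r. u r x) has_vector_derivative - advection (u t) x - G t x) (at t within ?U)"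
    by blast
  have "bounded ((\<lambda>t. holder_norm s (u t)) ` {0..T / 2})"
    using sol T unfolding euler_solution_def by auto
  then obtain K0 where K0: "\<And>t. t \<in> {0..T / 2} \<Longrightarrow> holder_norm s (u t) \<le> K0"
    unfolding bounded_iff ball_simps real_norm_def by (meson abs_le_D1)
  define K where "K = max 1 K0"
  have K: "1 \<le> K" "\<And>t. t \<in> {0..T / 2} \<Longrightarrow> holder_norm s (u t) \<le> K"
    unfolding K_def using K0 by (auto simp: le_max_iff_disj)
  \<comment> \<open>The advection terms will differ by at most \<open>4 K e d\<^sup>s = d\<^sup>s / 16\<close> over the distance \<open>d\<close>. This costs
    \<open>d\<^bsup>1+s\<^esup> / 8\<close> of the circulation, half of the initial amount.\<close>
  define e where "e = 1 / (64 * K)"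
  have e: "0 < e" "e \<le> 1" "K * e = 1 / 64"
    using K unfolding e_def by (auto simp: divide_le_eq)
  obtain t1 where t1: "0 < t1" "\<And>r. r \<in> ?U \<Longrightarrow> r \<noteq> 0 \<Longrightarrow> dist r 0 < t1 \<Longrightarrow> holder_dist s (u r) (u 0) < e"
    using order_tendstoD(2)[OF lim[of 0], of e] e T unfolding eventually_at by auto
  define t where "t = min t1 T / 2"
  have t: "0 < t" "t \<le> T / 2" "t < t1" "t < T"
    using t1 T unfolding t_def by auto
  have "holder_dist s (u 0) (u 0) = holder_dist s (\<lambda>x. u 0 x + 0) (u 0)"
    by simp
  also have "\<dots> \<le> 0"
    using holder_dist_const[of s "u 0" 0] by simp
  finally have close: "holder_dist s (u r) (u 0) \<le> e" if "r \<in> {0..t}" for r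
    using t1(2)[of r] that t e by (cases "r = 0") auto

  note cont = holder_space_continuous[OF H s(1)]
  define W where "W r x = - advection (u r) x - G r x" for r x
  have contW: "continuous_on (?U \<times> UNIV) (\<lambda>(r, x). W r x)"
  proof -
    have "continuous_on (?U \<times> UNIV) (\<lambda>(r, x). u r x)"
      using holder_dist_bounds(1)[OF H H]
      by (intro continuous_on_timesI[where d = "\<lambda>r t. holder_dist s (u r) (u t)"] cont lim)
        (simp_all add: dist_norm)
    moreover have "continuous_on (?U \<times> UNIV) (\<lambda>(r, x). jacobian (u r) (at x))"
      using holder_dist_bounds(2)[OF H H]
      by (intro continuous_on_timesI[where d = "\<lambda>r t. holder_dist s (u r) (u t)"] cont lim)
        (simp_all add: dist_norm)
    ultimately have "continuous_on (?U \<times> UNIV) (\<lambda>(r, x). advection (u r) x)"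
      unfolding advection_def split_beta
      by (intro bounded_bilinear.continuous_on[OF bounded_bilinear_matrix_vector_mult])
    then show ?thesis
      using G unfolding W_def split_beta by (intro continuous_intros)
  qed

  \<comment> \<open>Both bounds on the change of the circulation up to time \<open>t\<close>, divided by \<open>d\<close>; here \<open>t\<close> was chosen
    before \<open>d\<close>.\<close>
  have key: "t * d powr s \<le> 16 * d" if d: "0 < d" "d \<le> 1" for d
  proof -
    let ?c = "\<lambda>r. circulation d (u r)"
    have deriv: "(?c has_vector_derivative - circulation d (advection (u r))) (at r within {0..t})"
      if r: "r \<in> {0..t}" for r
    proof -
      have rU: "r \<in> ?U" using r t by auto
      have "continuous_on UNIV (\<lambda>x. (r, x))"
        by (intro continuous_intros)
      from continuous_on_compose2[OF G this] have Gr: "continuous_on UNIV (G r)"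
        using rU by (simp add: image_subset_iff)
      have "circulation d (W r) = circulation d (\<lambda>x. (0 - advection (u r) x) - G r x)"
        by (simp add: W_def[abs_def])
      also have "\<dots> = circulation d (\<lambda>x. 0 - advection (u r) x) - circulation d (G r)"
        by (intro circulation_diff continuous_intros cont rU Gr)
      also have "circulation d (\<lambda>x. 0 - advection (u r) x)
          = circulation d (\<lambda>x. 0) - circulation d (advection (u r))"
        by (intro circulation_diff continuous_intros cont rU)
      also have "circulation d (G r) = 0"
        using circulation_gradient[OF p[OF rU]] d by simp
      also have "circulation d (\<lambda>x. 0) = 0"
        by (simp add: circulation_def)
      finally have W: "circulation d (W r) = - circulation d (advection (u r))"
        by simp
      have "(?c has_vector_derivative circulation d (W r)) (at r within ?U)"
        by (rule circulation_has_derivative[OF _ cont(1) contW _ rU])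
          (use ode in \<open>auto simp: W_def\<close>)
      then show ?thesis
        unfolding W by (rule has_vector_derivative_within_subset) (use t in auto)
    qed
    have lower: "d * d powr s / 8 \<le> circulation d (advection (u r))" if r: "r \<in> {0..t}" for r
    proof -
      have rU: "r \<in> ?U" "0 \<in> ?U" using r t T by auto
      let ?a = "\<lambda>x. advection (u r) x - advection (u 0) x"
      have "\<bar>circulation d ?a\<bar> \<le> 2 * (d powr s / 16) * d"
      proof (rule abs_circulation_le)
        show "continuous_on UNIV ?a"
          by (intro continuous_intros cont rU)
        fix x y :: "real^3" assume xy: "dist x y = d"
        have "norm (?a x - ?a y) \<le> 4 * K * holder_dist s (u r) (u 0) * d powr s"
          using norm_advection_diff_le[OF H[OF rU(1)] H[OF rU(2)] K(2) K(2), of x y] xy r t T d s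
          by auto
        also have "\<dots> \<le> 4 * K * e * d powr s"
          using close[OF r] K by (intro mult_right_mono mult_left_mono) auto
        also have "\<dots> = d powr s / 16"
          using e by simp
        finally show "norm (?a x - ?a y) \<le> d powr s / 16" .
      qed (use d in simp)
      moreover have "circulation d ?a = circulation d (advection (u r)) - circulation d (advection (u 0))"
        by (intro circulation_diff cont rU)
      moreover have "circulation d (advection (u 0)) = d * cusp_deriv s d"
        unfolding u0 advection_shear[OF cusp_has_derivative[OF s(1)]]
        using circulation_profile[of d "cusp_deriv s"] d s by simp
      moreover have "d * (d powr s / 4) \<le> d * cusp_deriv s d"
        using cusp_deriv_ge[of s d] d s by (intro mult_left_mono) auto
      moreover have "2 * (d powr s / 16) * d = d * d powr s / 8" "d * (d powr s / 4) = d * d powr s / 4"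
        by simp_all
      ultimately show ?thesis by linarith
    qed
    obtain r where r: "r \<in> {0<..<t}" "?c t - ?c 0 = (t - 0) * - circulation d (advection (u r))"
      using mvt_simple[OF t(1), of ?c "\<lambda>r y. y * - circulation d (advection (u r))"] deriv
      unfolding has_vector_derivative_def by auto
    have tU: "t \<in> ?U" "0 \<in> ?U" using t by auto
    let ?z = "\<lambda>x. u t x - u 0 x"
    have "\<bar>circulation d ?z\<bar> \<le> 2 * d * d"
    proof (rule abs_circulation_le)
      show "continuous_on UNIV ?z"
        by (intro continuous_intros cont tU)
      fix x y :: "real^3" assume "dist x y = d"
      then have "norm (?z x - ?z y) \<le> holder_dist s (u t) (u 0) * d"
        using holder_space_lipschitz[OF holder_space_diff[OF H[OF tU(1)] H[OF tU(2)]], of x y]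
        unfolding holder_dist_def by simp
      also have "\<dots> \<le> 1 * d"
        using close[of t] t e d by (intro mult_right_mono) auto
      finally show "norm (?z x - ?z y) \<le> d" by simp
    qed (use d in simp)
    moreover have "circulation d ?z = ?c t - ?c 0"
      by (intro circulation_diff cont tU)
    moreover have "t * (d * d powr s / 8) \<le> t * circulation d (advection (u r))"
      using lower[of r] r t by (intro mult_left_mono) auto
    ultimately have "t * (d * d powr s / 8) \<le> 2 * d * d"
      using r(2) by (simp add: abs_le_iff)
    then have "d * (t * d powr s) \<le> d * (16 * d)"
      by (simp add: algebra_simps)
    then show ?thesis
      using d by simp
  qed

  \<comment> \<open>Solves \<open>d\<^bsup>1-s\<^esup> = t / 32\<close> when this has a solution in the unit interval.\<close>
  define d where "d = min 1 (t / 32) powr (1 / (1 - s))"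
  have d: "0 < d" "d \<le> 1"
    using t s unfolding d_def by (auto intro!: powr_le1)
  have "d powr (1 - s) = min 1 (t / 32)"
    using s t unfolding d_def by (simp add: powr_powr)
  then have "d powr (1 - s) < t / 16"
    using t by linarith
  then have "d powr (1 - s) * d powr s < t / 16 * d powr s"
    using d by (intro mult_strict_right_mono) auto
  then have "16 * d < t * d powr s"
    using d by (simp flip: powr_add)
  then show False
    using key[OF d] by linarith
qed

section \<open>Ill-posedness\<close>

lemma cusp_shear_data:
  "0 < s \<Longrightarrow> s < 1 \<Longrightarrow> shear c (cusp s) \<in> initial_data s"
  by (rule shear_holder_space(1)[OF cusp_has_derivative abs_cusp_le abs_cusp_deriv_le cusp_deriv_holder])
    auto

lemma cusp_shear_solution:
  "0 < s \<Longrightarrow> s < 1 \<Longrightarrow>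
    euler_solution s T (shear c (cusp s)) (\<lambda>t. shear c (\<lambda>y. cusp s (y - c * t)))"
  by (rule euler_solution_shear[OF cusp_has_derivative abs_cusp_le abs_cusp_deriv_le cusp_deriv_holder])
    auto

text \<open>Whatever the space \<open>Y\<close>, the solution that it must contain is Hoelder-continuous in time.\<close>

lemma locally_ill_posed:
  assumes "0 < s" and "s < 1"
  shows "locally_ill_posed s"
  unfolding locally_ill_posed_def
proof
  let ?u0 = "shear 1 (cusp s)"
  assume "locally_well_posed s"
  then obtain T Y r S where T: "0 < T" and r: "0 < r" and Y: "Y \<subseteq> continuous_curves s T"
    and S: "\<And>v0. v0 \<in> initial_data s \<Longrightarrow> holder_dist s v0 ?u0 < r \<Longrightarrow>
      S v0 \<in> Y \<and> euler_solution s T v0 (S v0)"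
    unfolding locally_well_posed_def using cusp_shear_data[OF assms, of 1] by metis
  have "holder_dist s ?u0 ?u0 < r"
    using holder_dist_const[of s ?u0 0] r by simp
  then have "S ?u0 \<in> continuous_curves s T" "euler_solution s T ?u0 (S ?u0)"
    using S[OF cusp_shear_data[OF assms]] Y by auto
  then show False
    by (rule no_hoelder_continuous_solution[OF assms T])
qed

text \<open>The Jacobians differ by \<open>k(- a) - k(0) = k(a)\<close> on the plane \<open>x\<^sub>1 = 0\<close> and by \<open>- k(a)\<close> on
  \<open>x\<^sub>1 = a\<close>, with \<open>k\<close> the derivative of the profile, and \<open>k(a) \<ge> a\<^sup>s / 4\<close>.\<close>

lemma holder_dist_shifted_cusp_ge:
  assumes s: "0 < s" "s < 1" and a: "0 < a" "a \<le> 1"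
  shows "1 / 2 \<le> holder_dist s (shear c (\<lambda>y. cusp s (y - a))) (shear 0 (cusp s))"
proof -
  let ?v = "shear c (\<lambda>y. cusp s (y - a))" and ?u = "shear 0 (cusp s)"
  have D: "(cusp s has_real_derivative cusp_deriv s y) (at y)" for y
    by (rule cusp_has_derivative[OF s(1)])
  have D': "((\<lambda>y. cusp s (y - a)) has_real_derivative cusp_deriv s (y - a)) (at y)" for y
    using DERIV_chain2[OF D DERIV_diff[OF DERIV_ident DERIV_const]] by simp
  have "?v \<in> initial_data s"
  proof (rule shear_holder_space(1)[OF D' _ _ _ s(1)])
    show "\<bar>cusp s (y - a)\<bar> \<le> 1" "\<bar>cusp_deriv s (y - a)\<bar> \<le> 2" for y
      using abs_cusp_le abs_cusp_deriv_le s by simp_all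
    show "\<bar>cusp_deriv s (x - a) - cusp_deriv s (y - a)\<bar> \<le> 6 * \<bar>x - y\<bar> powr s" for x y
      using cusp_deriv_holder[of s "x - a" "y - a"] s by simp
  qed
  then have H: "?v \<in> holder_space s" "?u \<in> holder_space s"
    using cusp_shear_data[OF s, of 0] unfolding initial_data_def by blast+
  let ?J = "\<lambda>x. jacobian ?v (at x) - jacobian ?u (at x)"
  have J: "?J (plane_point b 0) = (cusp_deriv s (b - a) - cusp_deriv s b) *\<^sub>R axis 3 (axis 1 1)" for b
    unfolding jacobian_shear[OF D] jacobian_shear[OF D'] by (simp add: scaleR_diff_left)
  have "a powr s / 2 \<le> 2 * cusp_deriv s a"
    using cusp_deriv_ge[of s a] s a by simp
  also have "\<dots> \<le> norm (?J (plane_point 0 0) - ?J (plane_point a 0))"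
  proof -
    have "?J (plane_point 0 0) - ?J (plane_point a 0)
        = (2 * cusp_deriv s a) *\<^sub>R axis 3 (axis 1 1)"
      unfolding J scaleR_diff_left[symmetric] using s by simp
    then show ?thesis
      by (simp only: norm_scaleR norm_axis norm_axis_1 real_norm_def mult_1_right abs_ge_self)
  qed
  also have "\<dots> \<le> holder_dist s ?v ?u * dist (plane_point 0 0) (plane_point a 0) powr s"
    by (rule holder_dist_bounds(3)[OF H])
  finally have "a powr s * (1 / 2) \<le> a powr s * holder_dist s ?v ?u"
    using a by (simp add: dist_plane_point mult.commute)
  then show ?thesis
    using a by (simp only: mult_le_cancel_left_pos powr_gt_zero)
qed

text \<open>The shift \<open>c t\<close> produced by a drift \<open>c\<close> is nonzero at every positive time, however small \<open>c\<close> is.\<close>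

lemma not_data_to_solution_continuous:
  assumes s: "0 < s" "s < 1" and t: "0 < t"
  shows "\<not> data_to_solution_continuous s T t"
proof
  let ?v = "\<lambda>c t. shear c (\<lambda>y. cusp s (y - c * t))"
  assume "data_to_solution_continuous s T t"
  then have "\<forall>e>0. \<exists>d>0. \<forall>v0 v. euler_solution s T v0 v \<and>
      holder_dist s v0 (shear 0 (cusp s)) < d \<longrightarrow> holder_dist s (v t) (?v 0 t) < e"
    unfolding data_to_solution_continuous_def
    using cusp_shear_solution[OF s, of T 0] by (elim allE[of _ "shear 0 (cusp s)"] allE[of _ "?v 0"] impE)
  moreover have "(0 :: real) < 1 / 2"
    by simp
  ultimately obtain d where d: "0 < d" "\<And>v0 v. euler_solution s T v0 v \<Longrightarrow>
      holder_dist s v0 (shear 0 (cusp s)) < d \<Longrightarrow> holder_dist s (v t) (?v 0 t) < 1 / 2"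
    by blast
  define c where "c = min (d / 2) (1 / t)"
  have c: "0 < c" "c < d"
    using d(1) t unfolding c_def by auto
  have "c * t \<le> 1 / t * t"
    unfolding c_def using t by (intro mult_right_mono) auto
  then have ct: "0 < c * t" "c * t \<le> 1"
    using c t by auto
  have "shear c (cusp s) = (\<lambda>x. shear 0 (cusp s) x + c *\<^sub>R axis 1 1)"
    by (simp add: shear_def fun_eq_iff)
  then have "holder_dist s (shear c (cusp s)) (shear 0 (cusp s)) < d"
    using holder_dist_const[of s "shear 0 (cusp s)" "c *\<^sub>R axis 1 1"] c by simp
  from d(2)[OF cusp_shear_solution[OF s] this]
  show False
    using holder_dist_shifted_cusp_ge[OF s ct, of c] by simp
qed

theorem mainTheorem2:
  fixes \<sigma> :: real
  assumes "0 < \<sigma>" and "\<sigma> < 1"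
  shows "locally_ill_posed \<sigma> \<and>
         (\<forall>T>0. \<forall>t\<in>{0<..<T}. \<not> data_to_solution_continuous \<sigma> T t)"
  using locally_ill_posed[OF assms] not_data_to_solution_continuous[OF assms] by auto

end
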